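(* For every integer $n\geq 1$, $\gamma_2(G_{3,n})=\lceil 4n/3\rceil$.
   Context: For a graph $G$, a set $D\subseteq V(G)$ is a $2$-dominating set if every vertex not in $D$ has at least $2$ neighbours in $D$. The $2$-domination number $\gamma_2(G)$ is the minimum cardinality of a $2$-dominating set of $G$. The grid graph $G_{m,n}=P_m\times P_n$ has vertex set $[m]\times[n]$ (where $[k]=\{1,\dots,k\}$), with $(i,j)$ and $(i',j')$ adjacent iff $|i-i'|+|j-j'|=1$. *)

theory Defs
  imports Complex_Main "Graph_Theory.Pair_Digraph"
begin

(* Finite simple graphs are the pair_graphs of Graph_Theory: each undirected edge is
   represented by its two opposite arcs. *)

definition neighbours :: "'a pair_pre_digraph \<Rightarrow> 'a \<Rightarrow> 'a set" where
  "neighbours G v = {u \<in> pverts G. (v, u) \<in> parcs G}"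

definition two_dominating :: "'a pair_pre_digraph \<Rightarrow> 'a set \<Rightarrow> bool" where
  "two_dominating G D \<longleftrightarrow>
     D \<subseteq> pverts G \<and> (\<forall>v \<in> pverts G - D. card (neighbours G v \<inter> D) \<ge> 2)"

definition two_domination_number :: "'a pair_pre_digraph \<Rightarrow> nat" where
  "two_domination_number G = Min (card ` {D. two_dominating G D})"

(* The whole vertex set is 2-dominating, so for finite G the minimum is over a finite,
   nonempty set. *)
lemma two_domination_number_welldef:
  assumes "finite (pverts G)"
  shows "finite (card ` {D. two_dominating G D})"
    and "card ` {D. two_dominating G D} \<noteq> {}"
proof -
  have "{D. two_dominating G D} \<subseteq> Pow (pverts G)"
    by (auto simp: two_dominating_def)
  then show "finite (card ` {D. two_dominating G D})"
    using assms by (meson finite_Pow_iff finite_imageI finite_subset)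
  have "two_dominating G (pverts G)"
    by (simp add: two_dominating_def)
  then show "card ` {D. two_dominating G D} \<noteq> {}"
    by blast
qed

(* Coordinates are compared in int, since subtraction on nat truncates. *)
definition grid_graph :: "nat \<Rightarrow> nat \<Rightarrow> (nat \<times> nat) pair_pre_digraph" where
  "grid_graph m n =
     \<lparr> pverts = {1..m} \<times> {1..n},
       parcs = {((i, j), (i', j')) | i j i' j'.
                  (i, j) \<in> {1..m} \<times> {1..n} \<and> (i', j') \<in> {1..m} \<times> {1..n} \<and>
                  \<bar>int i - int i'\<bar> + \<bar>int j - int j'\<bar> = 1} \<rparr>"

lemma pair_graph_grid_graph: "pair_graph (grid_graph m n)"
proof
  show "finite (parcs (grid_graph m n))"
    by (rule finite_subset[of _ "({1..m} \<times> {1..n}) \<times> ({1..m} \<times> {1..n})"])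
      (auto simp: grid_graph_def)
  show "symmetric (with_proj (grid_graph m n))"
    by (auto simp: symmetric_def grid_graph_def intro!: symI)
qed (auto simp: grid_graph_def)

end

theory Submission
  imports Defs
begin

text \<open>
  Read the grid as \<open>n\<close> columns of three vertices. For the lower bound, let \<open>s j\<close> be three times
  the number of chosen vertices in the first \<open>j\<close> columns, minus \<open>4 * j\<close>. The number \<open>s j\<close> can be
  negative, but only by an amount that column \<open>j + 1\<close> is forced to pay back: it is bounded below
  by a function \<open>surplus\<close> of columns \<open>j\<close> and \<open>j + 1\<close>, which is nonnegative when column \<open>j + 1\<close>
  is empty. With an empty column \<open>n + 1\<close> this gives \<open>s n \<ge> 0\<close>. For the upper bound, the columns
  alternate periodically between middle, outer two, middle; if \<open>n mod 3 = 1\<close>, the last column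
  is replaced by its outer two vertices.
\<close>

lemma card_four_Int:
  assumes "distinct [a, b, c, d]"
  shows "card ({a, b, c, d} \<inter> D) =
    of_bool (a \<in> D) + of_bool (b \<in> D) + of_bool (c \<in> D) + of_bool (d \<in> D)"
  using assms by (auto simp: Int_insert_left)

text \<open>Positions outside the grid contribute 0 because \<open>D\<close> lies inside it, so
  boundary vertices need no separate treatment. As \<open>i\<close> and \<open>j\<close> are
  positive, the truncated \<open>i - 1\<close> and \<open>j - 1\<close> really move one place, and
  the four positions are distinct.\<close>

lemma card_neighbours_grid_graph:
  assumes "D \<subseteq> pverts (grid_graph m n)" and "i \<in> {1..m}" and "j \<in> {1..n}"
  shows "card (neighbours (grid_graph m n) (i, j) \<inter> D) =
    of_bool ((i - 1, j) \<in> D) + of_bool ((i + 1, j) \<in> D) +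
    of_bool ((i, j - 1) \<in> D) + of_bool ((i, j + 1) \<in> D)"
proof -
  have "neighbours (grid_graph m n) (i, j) \<inter> D =
      {(i - 1, j), (i + 1, j), (i, j - 1), (i, j + 1)} \<inter> D"
  proof (intro set_eqI iffI)
    fix x assume "x \<in> neighbours (grid_graph m n) (i, j) \<inter> D"
    then obtain k l where x: "x = (k, l)" "(k, l) \<in> D"
      and d: "\<bar>int i - int k\<bar> + \<bar>int j - int l\<bar> = 1"
      by (cases x) (auto simp: neighbours_def grid_graph_def)
    have "k = i - 1 \<and> l = j \<or> k = i + 1 \<and> l = j \<or> k = i \<and> l = j - 1 \<or> k = i \<and> l = j + 1"
      using d by linarith
    with x show "x \<in> {(i - 1, j), (i + 1, j), (i, j - 1), (i, j + 1)} \<inter> D"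
      by auto
  next
    fix x assume "x \<in> {(i - 1, j), (i + 1, j), (i, j - 1), (i, j + 1)} \<inter> D"
    with assms show "x \<in> neighbours (grid_graph m n) (i, j) \<inter> D"
      by (auto simp: neighbours_def grid_graph_def)
  qed
  also have "card \<dots> = of_bool ((i - 1, j) \<in> D) + of_bool ((i + 1, j) \<in> D) +
    of_bool ((i, j - 1) \<in> D) + of_bool ((i, j + 1) \<in> D)"
    using assms(2,3) by (intro card_four_Int) auto
  finally show ?thesis .
qed

lemma card_eq_sum_columns:
  fixes D :: "(nat \<times> nat) set"
  assumes "D \<subseteq> {1..3} \<times> {1..n}"
  shows "card D =
    (\<Sum>j=1..n. of_bool ((1, j) \<in> D) + of_bool ((2, j) \<in> D) + of_bool ((3, j) \<in> D))"
proof -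
  have "card D = (\<Sum>x\<in>{1..3} \<times> {1..n}. of_bool (x \<in> D))"
    using assms by (simp add: Int_absorb1 flip: Int_def)
  also have "\<dots> = (\<Sum>i=1..3. \<Sum>j=1..n. of_bool ((i, j) \<in> D))"
    by (simp add: sum.cartesian_product case_prod_unfold del: sum_of_bool_eq)
  also have "\<dots> = (\<Sum>j=1..n. \<Sum>i=1..3. of_bool ((i, j) \<in> D))"
    by (rule sum.swap)
  finally show ?thesis
    by (simp add: eval_nat_numeral del: sum_of_bool_eq)
qed

text \<open>
  The values are, essentially, the shortest-path distances in the graph of admissible consecutive
  pairs of columns, where entering column \<open>c\<close> costs \<open>3 * card c - 4\<close>.
\<close>

definition surplus :: "bool \<Rightarrow> bool \<Rightarrow> bool \<Rightarrow> bool \<Rightarrow> bool \<Rightarrow> bool \<Rightarrow> int" where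
  "surplus a1 a2 a3 b1 b2 b3 =
    (if a2 then 2 * of_bool a1 + 2 * of_bool a3 - of_bool (\<not> a1 \<and> \<not> a3 \<and> b1 \<and> b3)
     else if a1 \<and> a3 then 1
     else of_bool (a1 \<and> \<not> (b2 \<and> b3) \<or> a3 \<and> \<not> (b1 \<and> b2)))"

text \<open>For consecutive columns a, b, c the assumptions say that b is dominated. Column b is
  charged only when c is known, since its domination depends on c. The inequality makes
  \<open>surplus\<close> a feasible potential: it never grows by more than the cost of the step. It
  is a finite check.\<close>

lemma surplus_step:
  assumes "b1 \<or> of_bool a1 + of_bool b2 + of_bool c1 \<ge> (2 :: nat)"
    and "b2 \<or> of_bool a2 + of_bool b1 + of_bool b3 + of_bool c2 \<ge> (2 :: nat)"
    and "b3 \<or> of_bool a3 + of_bool b2 + of_bool c3 \<ge> (2 :: nat)"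
  shows "surplus b1 b2 b3 c1 c2 c3 \<le>
    surplus a1 a2 a3 b1 b2 b3 + 3 * (of_bool b1 + of_bool b2 + of_bool b3) - 4"
  using assms unfolding surplus_def
  by (cases b1; cases b2; cases b3; cases a1; cases a2; cases a3)
    (auto simp: of_bool_def split: if_splits)

text \<open>The only negative value is -1, for a column with just its middle vertex, and it requires
  both outer vertices in the column to its right.\<close>

lemma surplus_empty_right: "surplus a1 a2 a3 False False False \<ge> 0"
  by (simp add: surplus_def)

lemma two_dominating_grid_lower:
  assumes "two_dominating (grid_graph 3 n) D"
  shows "4 * n \<le> 3 * card D"
proof -
  define c :: "nat \<Rightarrow> int" where
    "c j = of_bool ((1, j) \<in> D) + of_bool ((2, j) \<in> D) + of_bool ((3, j) \<in> D)" for j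
  define t where
    "t j = surplus ((1, j) \<in> D) ((2, j) \<in> D) ((3, j) \<in> D)
      ((1, j + 1) \<in> D) ((2, j + 1) \<in> D) ((3, j + 1) \<in> D)" for j
  have sub: "D \<subseteq> pverts (grid_graph 3 n)"
    using assms by (simp add: two_dominating_def)
  then have D: "D \<subseteq> {1..3} \<times> {1..n}"
    by (simp add: grid_graph_def)
  \<comment> \<open>Rows 0 and 4 remove the missing neighbours of the outer rows. The empty column 0
    gives \<open>t 0 = 0\<close>, and the empty column \<open>Suc n\<close> gives
    \<open>t n \<ge> 0\<close>.\<close>
  have out: "(0, j) \<notin> D" "(4, j) \<notin> D" "(i, 0) \<notin> D" "(i, Suc n) \<notin> D" for i j
    using D by auto
  have dom: "(i, j) \<in> D \<or> of_bool ((i - 1, j) \<in> D) + of_bool ((i + 1, j) \<in> D) +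
      of_bool ((i, j - 1) \<in> D) + of_bool ((i, j + 1) \<in> D) \<ge> (2 :: nat)"
    if "i \<in> {1..3}" "j \<in> {1..n}" for i j
  proof (cases "(i, j) \<in> D")
    case False
    with that have "(i, j) \<in> pverts (grid_graph 3 n) - D"
      by (simp add: grid_graph_def)
    with assms have "card (neighbours (grid_graph 3 n) (i, j) \<inter> D) \<ge> 2"
      unfolding two_dominating_def by blast
    then show ?thesis
      unfolding card_neighbours_grid_graph[OF sub that] by (rule disjI2)
  qed simp
  have step: "t (Suc j) \<le> t j + 3 * c (Suc j) - 4" if "Suc j \<le> n" for j
    unfolding t_def c_def Suc_eq_plus1
  proof (rule surplus_step)
    show "(1, j + 1) \<in> D \<or> of_bool ((1, j) \<in> D) + of_bool ((2, j + 1) \<in> D) +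
        of_bool ((1, j + 1 + 1) \<in> D) \<ge> (2 :: nat)"
      using dom[of 1 "j + 1"] that out by (simp add: eval_nat_numeral add_ac)
    show "(2, j + 1) \<in> D \<or> of_bool ((2, j) \<in> D) + of_bool ((1, j + 1) \<in> D) +
        of_bool ((3, j + 1) \<in> D) + of_bool ((2, j + 1 + 1) \<in> D) \<ge> (2 :: nat)"
      using dom[of 2 "j + 1"] that by (simp add: eval_nat_numeral add_ac)
    show "(3, j + 1) \<in> D \<or> of_bool ((3, j) \<in> D) + of_bool ((2, j + 1) \<in> D) +
        of_bool ((3, j + 1 + 1) \<in> D) \<ge> (2 :: nat)"
      using dom[of 3 "j + 1"] that out by (simp add: eval_nat_numeral add_ac)
  qed
  have "t k \<le> 3 * (\<Sum>j=1..k. c j) - 4 * int k" if "k \<le> n" for k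
    using that
  proof (induction k)
    case 0
    then show ?case
      using out by (simp add: t_def surplus_def)
  next
    case (Suc k)
    then show ?case
      using step[of k] by simp
  qed
  from this[of n] have "t n \<le> 3 * (\<Sum>j=1..n. c j) - 4 * int n"
    by simp
  moreover have "t n \<ge> 0"
    using out surplus_empty_right by (simp add: t_def)
  moreover have "int (card D) = (\<Sum>j=1..n. c j)"
    by (simp add: card_eq_sum_columns[OF D] c_def)
  ultimately show ?thesis
    by linarith
qed

definition grid_pattern :: "nat \<Rightarrow> (nat \<times> nat) set" where
  "grid_pattern n = {(i, j). i \<in> {1..3} \<and> j \<in> {1..n} \<and>
    (i \<noteq> 2 \<longleftrightarrow> j mod 3 = 2 \<or> j = n \<and> n mod 3 = 1)}"

text \<open>Every column is either the middle vertex or the two outer ones, so a missing middle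
  vertex has both outer neighbours. A missing outer vertex has the middle one and a second neighbour
  in the adjacent column congruent to 2 modulo 3. That column could fall outside the grid only for
  \<open>j = n\<close> with \<open>n mod 3 = 1\<close>, which the modified last column rules
  out.\<close>

lemma two_dominating_grid_pattern: "two_dominating (grid_graph 3 n) (grid_pattern n)"
  unfolding two_dominating_def
proof (intro conjI ballI)
  show sub: "grid_pattern n \<subseteq> pverts (grid_graph 3 n)"
    by (auto simp: grid_pattern_def grid_graph_def)
  fix v assume "v \<in> pverts (grid_graph 3 n) - grid_pattern n"
  then obtain i j where v: "v = (i, j)" "i \<in> {1..3}" "j \<in> {1..n}" "(i, j) \<notin> grid_pattern n"
    by (auto simp: grid_graph_def)
  show "2 \<le> card (neighbours (grid_graph 3 n) v \<inter> grid_pattern n)"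
  proof (cases "i = 2")
    case True
    with v have "(1, j) \<in> grid_pattern n" "(3, j) \<in> grid_pattern n"
      by (auto simp: grid_pattern_def)
    with True v show ?thesis
      by (simp add: card_neighbours_grid_graph[OF sub])
  next
    case False
    with v have "(2, j) \<in> grid_pattern n" and j: "j mod 3 \<noteq> 2" "\<not> (j = n \<and> n mod 3 = 1)"
      by (auto simp: grid_pattern_def)
    moreover have "i = 1 \<or> i = 3"
      using False v by auto
    moreover have "(i, j - 1) \<in> grid_pattern n \<or> (i, j + 1) \<in> grid_pattern n"
    proof (cases "j mod 3 = 0")
      case True
      moreover from v(3) obtain l where "j = Suc l"
        by (cases j) auto
      ultimately have "(j - 1) mod 3 = 2" "j - 1 \<ge> 1"
        by (auto simp: mod_Suc Suc_le_eq split: if_splits intro: gr0I)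
      then show ?thesis
        using False v by (auto simp: grid_pattern_def)
    next
      case False
      with j(1) have "j mod 3 = 1"
        using mod_less_divisor[of 3 j] by linarith
      with j(2) have "(j + 1) mod 3 = 2" "j \<noteq> n"
        by (auto simp: mod_Suc)
      then show ?thesis
        using \<open>i \<noteq> 2\<close> v by (auto simp: grid_pattern_def)
    qed
    ultimately show ?thesis
      using v by (auto simp: card_neighbours_grid_graph[OF sub] numeral_2_eq_2)
  qed
qed

lemma card_grid_pattern:
  assumes "n \<ge> 1"
  shows "card (grid_pattern n) = (4 * n + 2) div 3"
proof -
  have "card (grid_pattern n) = (\<Sum>j=1..n. of_bool ((1, j) \<in> grid_pattern n) +
      of_bool ((2, j) \<in> grid_pattern n) + of_bool ((3, j) \<in> grid_pattern n))"
    by (rule card_eq_sum_columns) (auto simp: grid_pattern_def)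
  \<comment> \<open>An outer column has one vertex more than a middle one. Its two possible causes
    exclude each other, so they can be added.\<close>
  also have "\<dots> = (\<Sum>j=1..n. (1 + of_bool (j mod 3 = 2)) + (if j = n then of_bool (n mod 3 = 1) else 0))"
    by (rule sum.cong) (auto simp: grid_pattern_def)
  also have "\<dots> = (\<Sum>j=1..n. 1 + of_bool (j mod 3 = 2)) + of_bool (n mod 3 = 1)"
    using assms by (subst sum.distrib) simp
  \<comment> \<open>\<open>(k + 1) div 3\<close> counts the columns up to \<open>k\<close> that are
    congruent to 2 modulo 3.\<close>
  also have "(\<Sum>j=1..k. 1 + of_bool (j mod 3 = 2)) = k + (k + 1) div 3" for k :: nat
  proof (induction k)
    case (Suc k)
    have "of_bool (Suc k mod 3 = 2) + (k + 1) div 3 = (Suc k + 1) div 3"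
      unfolding of_bool_def by presburger
    with Suc show ?case
      by simp
  qed simp
  also have "n + (n + 1) div 3 + of_bool (n mod 3 = 1) = (4 * n + 2) div 3"
    unfolding of_bool_def by presburger
  finally show ?thesis .
qed

theorem theorem2:
  fixes n :: nat
  assumes "n \<ge> 1"
  shows "int (two_domination_number (grid_graph 3 n)) = \<lceil>4 * real n / 3\<rceil>"
proof -
  have fin: "finite (pverts (grid_graph 3 n))"
    by (simp add: grid_graph_def)
  \<comment> \<open>Adding 2 before dividing by 3 rounds up, so this quotient is the ceiling in
    natural numbers.\<close>
  have "two_domination_number (grid_graph 3 n) = (4 * n + 2) div 3"
    unfolding two_domination_number_def
  proof (rule Min_eqI[OF two_domination_number_welldef(1)[OF fin]])
    show "(4 * n + 2) div 3 \<in> card ` {D. two_dominating (grid_graph 3 n) D}"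
      using two_dominating_grid_pattern[of n] card_grid_pattern[OF assms] by force
  next
    fix k assume "k \<in> card ` {D. two_dominating (grid_graph 3 n) D}"
    then have "4 * n \<le> 3 * k"
      using two_dominating_grid_lower by auto
    then show "(4 * n + 2) div 3 \<le> k"
      by linarith
  qed
  moreover have "\<lceil>4 * real n / 3\<rceil> = int ((4 * n + 2) div 3)"
  proof (rule ceiling_unique)
    show "of_int (int ((4 * n + 2) div 3)) - 1 < 4 * real n / 3"
      using div_times_less_eq_dividend[of "4 * n + 2" 3] by linarith
    show "4 * real n / 3 \<le> of_int (int ((4 * n + 2) div 3))"
      using mod_less_divisor[of 3 "4 * n + 2"] div_mult_mod_eq[of "4 * n + 2" 3] by linarith
  qed
  ultimately show ?thesis
    by simp
qed

end
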